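(* Let $G$ and $H$ be two finite groups and $(\phi,\psi)$ be an isoclinism from $G$ to $H$. If $g\in G'$ and $\omega(x_1,x_2,\dots,x_n)$ is a non-trivial admissible word, then $$\Pr\nolimits_g^{\omega}(G)=\Pr\nolimits_{\psi(g)}^{\omega}(H).$$
   Context: $G'$ is the commutator subgroup, $Z(G)$ the center, $[x,y]=xyx^{-1}y^{-1}$. An isoclinism from $G$ to $H$ is a pair $(\phi,\psi)$ where $\phi:G/Z(G)\to H/Z(H)$ and $\psi:G'\to H'$ are isomorphisms such that $a_H\circ(\phi\times\phi)=\psi\circ a_G$, where $a_G(g_1Z(G),g_2Z(G))=[g_1,g_2]$ and $a_H(h_1Z(H),h_2Z(H))=[h_1,h_2]$. A word $\omega$ in the free group $F(x_1,\dots,x_n)$ is admissible if each generator $x_i$ that occurs in $\omega$ has precisely two non-zero indices in $\omega$, namely $+1$ and $-1$ (i.e. occurs exactly once as $x_i$ and exactly once as $x_i^{-1}$). For a finite group $G$ and $g\in G$, $\Pr_g^{\omega}(G)=|\{(g_1,\dots,g_n)\in G^n:\omega(g_1,\dots,g_n)=g\}|/|G^n|$. *)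

theory Defs
  imports Complex_Main "HOL-Algebra.Generated_Groups"
begin

section \<open>Isoclinism\<close>

definition center :: "('a, 'm) monoid_scheme \<Rightarrow> 'a set" where
  "center G = {z \<in> carrier G. \<forall>x \<in> carrier G. z \<otimes>\<^bsub>G\<^esub> x = x \<otimes>\<^bsub>G\<^esub> z}"

definition commutator :: "('a, 'm) monoid_scheme \<Rightarrow> 'a \<Rightarrow> 'a \<Rightarrow> 'a" where
  "commutator G x y = x \<otimes>\<^bsub>G\<^esub> y \<otimes>\<^bsub>G\<^esub> inv\<^bsub>G\<^esub> x \<otimes>\<^bsub>G\<^esub> inv\<^bsub>G\<^esub> y"

text \<open>The library constant \<^const>\<open>derived\<close> uses the same commutator convention.\<close>

definition derived_group :: "('a, 'm) monoid_scheme \<Rightarrow> ('a, 'm) monoid_scheme" where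
  "derived_group G = G \<lparr> carrier := derived G (carrier G) \<rparr>"

text \<open>
  The map \<open>(g1 Z(G), g2 Z(G)) \<mapsto> [g1, g2]\<close> on pairs of cosets of the center. That it is well
  defined is \<open>commutator_map_coset\<close> below.
\<close>
definition commutator_map :: "('a, 'm) monoid_scheme \<Rightarrow> 'a set \<Rightarrow> 'a set \<Rightarrow> 'a" where
  "commutator_map G A B = (THE c. \<exists>x\<in>A. \<exists>y\<in>B. c = commutator G x y)"

definition isoclinism ::
  "('a, 'm) monoid_scheme \<Rightarrow> ('b, 'n) monoid_scheme \<Rightarrow> ('a set \<Rightarrow> 'b set) \<Rightarrow> ('a \<Rightarrow> 'b) \<Rightarrow> bool"
where
  "isoclinism G H \<phi> \<psi> \<longleftrightarrow>
     \<phi> \<in> iso (G Mod center G) (H Mod center H) \<and>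
     \<psi> \<in> iso (derived_group G) (derived_group H) \<and>
     (\<forall>A \<in> carrier (G Mod center G). \<forall>B \<in> carrier (G Mod center G).
        commutator_map H (\<phi> A) (\<phi> B) = \<psi> (commutator_map G A B))"

lemma (in group) center_normal: "center G \<lhd> G"
proof -
  have i: "inv z \<in> center G" if z: "z \<in> center G" for z
  proof -
    have zc: "z \<in> carrier G" using z by (simp add: center_def)
    have "inv z \<otimes> x = x \<otimes> inv z" if x: "x \<in> carrier G" for x
    proof -
      have "z \<otimes> x = x \<otimes> z" using z x by (simp add: center_def)
      then show ?thesis
        by (metis inv_closed inv_solve_left inv_solve_right m_assoc m_closed x zc)
    qed
    then show ?thesis using zc by (simp add: center_def)
  qed
  have s: "subgroup (center G) G"
  proof (rule subgroupI)
    show "center G \<subseteq> carrier G" by (auto simp: center_def)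
    have "\<one> \<in> center G" by (simp add: center_def)
    then show "center G \<noteq> {}" by blast
    show "inv z \<in> center G" if "z \<in> center G" for z using i that .
    show "a \<otimes> b \<in> center G" if "a \<in> center G" "b \<in> center G" for a b
    proof -
      have ab: "a \<in> carrier G" "b \<in> carrier G" using that by (auto simp: center_def)
      have "a \<otimes> b \<otimes> x = x \<otimes> (a \<otimes> b)" if x: "x \<in> carrier G" for x
      proof -
        have ax: "a \<otimes> x = x \<otimes> a" and bx: "b \<otimes> x = x \<otimes> b"
          using \<open>a \<in> center G\<close> \<open>b \<in> center G\<close> x by (auto simp: center_def)
        have "a \<otimes> b \<otimes> x = a \<otimes> (x \<otimes> b)" using ab x bx by (simp add: m_assoc)
        also have "\<dots> = x \<otimes> a \<otimes> b" using ab x by (simp add: ax flip: m_assoc)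
        finally show ?thesis using ab x by (simp add: m_assoc)
      qed
      then show ?thesis using ab by (simp add: center_def)
    qed
  qed
  have "x \<otimes> h \<otimes> inv x \<in> center G" if "x \<in> carrier G" "h \<in> center G" for x h
  proof -
    have h: "h \<in> carrier G" and "x \<otimes> h = h \<otimes> x" using that by (auto simp: center_def)
    then have "x \<otimes> h \<otimes> inv x = h \<otimes> (x \<otimes> inv x)" using that(1) by (simp only: m_assoc inv_closed)
    then have "x \<otimes> h \<otimes> inv x = h" using that(1) h by simp
    then show ?thesis using that by simp
  qed
  then show ?thesis using s by (simp add: normal_inv_iff)
qed

lemma (in group) commutator_central:
  assumes z: "z \<in> center G" and w: "w \<in> center G" and x: "x \<in> carrier G" and y: "y \<in> carrier G"
  shows "commutator G (z \<otimes> x) (w \<otimes> y) = commutator G x y"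
proof -
  have zc: "z \<in> carrier G" and wc: "w \<in> carrier G" using z w by (auto simp: center_def)
  have zy: "z \<otimes> u = u \<otimes> z" and wy: "w \<otimes> u = u \<otimes> w" if "u \<in> carrier G" for u
    using z w that by (auto simp: center_def)
  have "(z \<otimes> x) \<otimes> (w \<otimes> y) = x \<otimes> y \<otimes> w \<otimes> z"
  proof -
    have "(z \<otimes> x) \<otimes> (w \<otimes> y) = z \<otimes> (x \<otimes> (w \<otimes> y))"
      using x y zc wc by (simp add: m_assoc)
    also have "\<dots> = x \<otimes> (w \<otimes> y) \<otimes> z" using x y wc by (intro zy) simp
    also have "\<dots> = x \<otimes> (y \<otimes> w) \<otimes> z" using wy[OF y] by simp
    finally have "(z \<otimes> x) \<otimes> (w \<otimes> y) = x \<otimes> (y \<otimes> w) \<otimes> z" .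
    then show ?thesis using x y wc by (simp only: m_assoc m_closed)
  qed
  then have "commutator G (z \<otimes> x) (w \<otimes> y)
      = x \<otimes> y \<otimes> w \<otimes> z \<otimes> (inv x \<otimes> inv z) \<otimes> (inv y \<otimes> inv w)"
    using x y zc wc by (simp add: commutator_def inv_mult_group)
  also have "\<dots> = x \<otimes> y \<otimes> w \<otimes> (z \<otimes> inv x \<otimes> inv z) \<otimes> inv y \<otimes> inv w"
    using x y zc wc by (simp add: m_assoc)
  also have "z \<otimes> inv x \<otimes> inv z = inv x" using x zc zy by (simp add: m_assoc)
  also have "x \<otimes> y \<otimes> w \<otimes> inv x \<otimes> inv y \<otimes> inv w = x \<otimes> y \<otimes> (w \<otimes> (inv x \<otimes> inv y) \<otimes> inv w)"
    using x y wc by (simp add: m_assoc)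
  also have "w \<otimes> (inv x \<otimes> inv y) \<otimes> inv w = inv x \<otimes> inv y"
    using x y wc wy[of "inv x \<otimes> inv y"] by (simp add: m_assoc)
  finally show ?thesis using x y by (simp add: commutator_def m_assoc)
qed

lemma (in group) commutator_map_coset:
  assumes x: "x \<in> carrier G" and y: "y \<in> carrier G"
  shows "commutator_map G (center G #> x) (center G #> y) = commutator G x y"
proof -
  have Z: "subgroup (center G) G" by (rule normal_imp_subgroup[OF center_normal])
  have self: "x \<in> center G #> x" "y \<in> center G #> y"
    by (rule rcos_self[OF x Z], rule rcos_self[OF y Z])
  have eq: "commutator G a b = commutator G x y"
    if ab: "a \<in> center G #> x" "b \<in> center G #> y" for a b
  proof -
    obtain z w where "z \<in> center G" "a = z \<otimes> x" "w \<in> center G" "b = w \<otimes> y"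
      using ab unfolding r_coset_def by blast
    then show ?thesis using commutator_central[OF _ _ x y] by simp
  qed
  show ?thesis
    unfolding commutator_map_def
  proof (rule the_equality)
    show "\<exists>a\<in>center G #> x. \<exists>b\<in>center G #> y. commutator G x y = commutator G a b"
      using self by blast
  next
    fix c assume "\<exists>a\<in>center G #> x. \<exists>b\<in>center G #> y. c = commutator G a b"
    then show "c = commutator G x y" using eq by blast
  qed
qed

section \<open>Words in a free group\<close>

text \<open>
  A letter \<open>(i, True)\<close> stands for the generator \<open>x\<^sub>i\<close> and \<open>(i, False)\<close> for its inverse; a power of
  a generator is spelled out as repeated letters. An element of the free group is represented
  by its unique reduced word.
\<close>

type_synonym letter = "nat \<times> bool"

definition letter_inv :: "letter \<Rightarrow> letter" where
  "letter_inv a = (fst a, \<not> snd a)"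

definition reduced :: "letter list \<Rightarrow> bool" where
  "reduced = successively (\<lambda>a b. b \<noteq> letter_inv a)"

fun push :: "letter \<Rightarrow> letter list \<Rightarrow> letter list" where
  "push a [] = [a]"
| "push a (b # w) = (if b = letter_inv a then w else a # b # w)"

text \<open>The product is concatenation followed by free cancellation.\<close>

definition free_group :: "nat \<Rightarrow> letter list monoid" where
  "free_group n = \<lparr> carrier = {w. reduced w \<and> fst ` set w \<subseteq> {1..n}},
                    mult = foldr push, one = [] \<rparr>"

definition admissible :: "letter list \<Rightarrow> bool" where
  "admissible w \<longleftrightarrow>
     (\<forall>i \<in> fst ` set w. count_list w (i, True) = 1 \<and> count_list w (i, False) = 1)"

definition letter_eval :: "('a, 'm) monoid_scheme \<Rightarrow> (nat \<Rightarrow> 'a) \<Rightarrow> letter \<Rightarrow> 'a" where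
  "letter_eval G g a = (if snd a then g (fst a) else inv\<^bsub>G\<^esub> (g (fst a)))"

definition word_eval :: "('a, 'm) monoid_scheme \<Rightarrow> (nat \<Rightarrow> 'a) \<Rightarrow> letter list \<Rightarrow> 'a" where
  "word_eval G g w = foldr (\<lambda>a h. letter_eval G g a \<otimes>\<^bsub>G\<^esub> h) w \<one>\<^bsub>G\<^esub>"

text \<open>Here \<open>G\<^sup>n\<close> is the set of functions \<^term>\<open>{1..n} \<rightarrow>\<^sub>E carrier G\<close>.\<close>

definition word_prob :: "('a, 'm) monoid_scheme \<Rightarrow> nat \<Rightarrow> letter list \<Rightarrow> 'a \<Rightarrow> real" where
  "word_prob G n w x =
     real (card {g \<in> {1..n} \<rightarrow>\<^sub>E carrier G. word_eval G g w = x})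
       / real (card ({1..n} \<rightarrow>\<^sub>E carrier G))"

lemma letter_inv_simps [simp]:
  "letter_inv (letter_inv a) = a" "fst (letter_inv a) = fst a"
  "letter_inv a = letter_inv b \<longleftrightarrow> a = b"
  by (auto simp: letter_inv_def prod_eq_iff)

lemma reduced_Nil [simp]: "reduced []"
  by (simp add: reduced_def)

lemma reduced_Cons:
  "reduced (a # w) \<longleftrightarrow> reduced w \<and> (\<forall>b v. w = b # v \<longrightarrow> b \<noteq> letter_inv a)"
  by (cases w) (auto simp: reduced_def)

lemma reduced_push: "reduced w \<Longrightarrow> reduced (push a w)"
  by (cases w) (auto simp: reduced_Cons)

lemma reduced_foldr_push: "reduced v \<Longrightarrow> reduced (foldr push u v)"
  by (induction u) (auto intro: reduced_push)

lemma push_push_inv: "reduced w \<Longrightarrow> push a (push (letter_inv a) w) = w"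
proof (cases w)
  case (Cons b v)
  assume "reduced w"
  then show ?thesis using Cons by (cases v) (auto simp: reduced_Cons)
qed simp

lemma push_eq_Cons: "reduced (a # w) \<Longrightarrow> push a w = a # w"
  by (cases w) (auto simp: reduced_Cons)

lemma foldr_push_push:
  assumes "reduced v" "reduced w"
  shows "foldr push (push a v) w = push a (foldr push v w)"
proof (cases v)
  case (Cons b v')
  have r: "reduced (foldr push v' w)" using assms(2) by (rule reduced_foldr_push)
  show ?thesis using Cons push_push_inv[OF r, of a] by auto
qed simp

lemma foldr_push_assoc:
  "reduced v \<Longrightarrow> reduced w \<Longrightarrow> foldr push (foldr push u v) w = foldr push u (foldr push v w)"
  by (induction u) (auto simp: foldr_push_push reduced_foldr_push)

lemma foldr_push_Nil: "reduced w \<Longrightarrow> foldr push w [] = w"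
  by (induction w) (auto simp: reduced_Cons push_eq_Cons)

lemma set_push: "set (push a w) \<subseteq> insert a (set w)"
  by (cases w) auto

lemma set_foldr_push: "set (foldr push u v) \<subseteq> set u \<union> set v"
proof (induction u)
  case (Cons a u)
  then show ?case using set_push[of a "foldr push u v"] by auto
qed simp

lemma reduced_inverse: "reduced w \<Longrightarrow> reduced (rev (map letter_inv w))"
proof -
  have e: "a \<noteq> letter_inv b \<longleftrightarrow> b \<noteq> letter_inv a" for a b
    by (metis letter_inv_simps(1))
  assume "reduced w"
  then have "successively (\<lambda>a b. a \<noteq> letter_inv b) w"
    unfolding reduced_def by (subst e)
  then show ?thesis by (simp add: reduced_def successively_map)
qed

lemma foldr_push_inverse: "foldr push (rev (map letter_inv w)) w = []"
  by (induction w) auto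

lemma group_free_group: "group (free_group n)"
proof (rule groupI)
  fix x y assume "x \<in> carrier (free_group n)" "y \<in> carrier (free_group n)"
  then have xy: "reduced x" "reduced y" "fst ` set x \<subseteq> {1..n}" "fst ` set y \<subseteq> {1..n}"
    by (simp_all add: free_group_def)
  have "fst ` set (foldr push x y) \<subseteq> {1..n}"
    using set_foldr_push[of x y] xy(3,4) by blast
  then show "x \<otimes>\<^bsub>free_group n\<^esub> y \<in> carrier (free_group n)"
    using reduced_foldr_push[OF xy(2), of x] by (simp add: free_group_def)
next
  show "\<one>\<^bsub>free_group n\<^esub> \<in> carrier (free_group n)" by (simp add: free_group_def)
next
  fix x y z
  assume "x \<in> carrier (free_group n)" "y \<in> carrier (free_group n)" "z \<in> carrier (free_group n)"
  then show "x \<otimes>\<^bsub>free_group n\<^esub> y \<otimes>\<^bsub>free_group n\<^esub> z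
      = x \<otimes>\<^bsub>free_group n\<^esub> (y \<otimes>\<^bsub>free_group n\<^esub> z)"
    by (simp add: free_group_def foldr_push_assoc)
next
  fix x assume "x \<in> carrier (free_group n)"
  show "\<one>\<^bsub>free_group n\<^esub> \<otimes>\<^bsub>free_group n\<^esub> x = x" by (simp add: free_group_def)
next
  fix x assume x: "x \<in> carrier (free_group n)"
  let ?y = "rev (map letter_inv x)"
  have "?y \<in> carrier (free_group n)"
    using x by (simp add: free_group_def reduced_inverse image_image)
  moreover have "?y \<otimes>\<^bsub>free_group n\<^esub> x = \<one>\<^bsub>free_group n\<^esub>"
    by (simp only: free_group_def monoid.simps partial_object.simps foldr_push_inverse)
  ultimately show "\<exists>y\<in>carrier (free_group n). y \<otimes>\<^bsub>free_group n\<^esub> x = \<one>\<^bsub>free_group n\<^esub>"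
    by blast
qed

text \<open>
  \<^const>\<open>word_eval\<close> is the homomorphism from the free group sending each generator \<open>x\<^sub>i\<close> to \<open>g i\<close>.
\<close>

lemma (in group) word_eval_hom:
  assumes g: "g \<in> {1..n} \<rightarrow> carrier G"
  shows "word_eval G g \<in> hom (free_group n) G"
proof -
  have L: "letter_eval G g a \<in> carrier G" if "fst a \<in> {1..n}" for a
    using g that by (auto simp: letter_eval_def Pi_iff)
  have W: "word_eval G g w \<in> carrier G" if "fst ` set w \<subseteq> {1..n}" for w
    using that by (induction w) (auto simp: word_eval_def L)
  have P: "word_eval G g (push a w) = letter_eval G g a \<otimes> word_eval G g w"
    if "fst a \<in> {1..n}" "fst ` set w \<subseteq> {1..n}" for a w
  proof (cases w)
    case (Cons b v)
    have i: "letter_eval G g a \<otimes> letter_eval G g (letter_inv a) = \<one>"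
      using g that(1) by (auto simp: letter_eval_def letter_inv_def Pi_iff)
    have v: "word_eval G g v \<in> carrier G" using that Cons by (intro W) auto
    have "letter_eval G g a \<otimes> (letter_eval G g (letter_inv a) \<otimes> word_eval G g v) = word_eval G g v"
      using that v L[of a] L[of "letter_inv a"] i by (simp flip: m_assoc)
    then show ?thesis using Cons by (auto simp: word_eval_def)
  qed (simp add: word_eval_def)
  have M: "word_eval G g (foldr push u v) = word_eval G g u \<otimes> word_eval G g v"
    if "fst ` set u \<subseteq> {1..n}" "fst ` set v \<subseteq> {1..n}" for u v
    using that(1)
  proof (induction u)
    case Nil
    show ?case using W[OF that(2)] by (simp add: word_eval_def)
  next
    case (Cons a u)
    have a: "fst a \<in> {1..n}" and u: "fst ` set u \<subseteq> {1..n}" using Cons.prems by auto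
    have "fst ` set (foldr push u v) \<subseteq> {1..n}"
      using set_foldr_push[of u v] u that(2) by blast
    then have "word_eval G g (foldr push (a # u) v)
        = letter_eval G g a \<otimes> word_eval G g (foldr push u v)"
      using P[OF a] by simp
    also have "\<dots> = letter_eval G g a \<otimes> (word_eval G g u \<otimes> word_eval G g v)"
      using Cons.IH[OF u] by simp
    also have "\<dots> = letter_eval G g a \<otimes> word_eval G g u \<otimes> word_eval G g v"
      using L[OF a] W[OF u] W[OF that(2)] by (simp add: m_assoc)
    finally show ?case by (simp add: word_eval_def)
  qed
  show ?thesis using W M by (auto simp: hom_def free_group_def)
qed

lemma (in group) word_eval_generator:
  "g i \<in> carrier G \<Longrightarrow> word_eval G g [(i, True)] = g i"
  by (simp add: word_eval_def letter_eval_def)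

end

theory Submission
  imports Defs
begin

text \<open>
  Let \<open>K = {(a, b) \<in> G \<times> H. \<phi> (a Z(G)) = b Z(H)}\<close> be the fibre product of \<open>G\<close> and \<open>H\<close> over their
  identified central quotients; it is a subgroup of \<open>G \<times> H\<close>. Compatibility of \<open>(\<phi>, \<psi>)\<close> with
  commutators says exactly that the commutator of two elements of \<open>K\<close> has the form \<open>(c, \<psi> c)\<close>.
  The graph of \<open>\<psi>\<close> is a subgroup of \<open>G \<times> H\<close>, so it contains \<open>K'\<close> (lemma \<open>derived_fibre_product\<close>).

  An admissible word takes values in the commutator subgroup of any group (lemma
  \<open>admissible_word_eval_derived\<close>): a word \<open>x u x\<^sup>-\<^sup>1 v\<close> evaluates to \<open>[x, u] u v\<close>, and \<open>u v\<close> is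
  again admissible. Applied to \<open>K\<close>, this shows that tuples \<open>(g\<^sub>1, \<dots>, g\<^sub>n)\<close> and \<open>(h\<^sub>1, \<dots>, h\<^sub>n)\<close>
  with all \<open>(g\<^sub>i, h\<^sub>i) \<in> K\<close> satisfy \<open>\<omega>(h\<^sub>1, \<dots>, h\<^sub>n) = \<psi>(\<omega>(g\<^sub>1, \<dots>, g\<^sub>n))\<close>.

  Finally, every element of \<open>G\<close> is related by \<open>K\<close> to exactly \<open>|Z(H)|\<close> elements of \<open>H\<close>, and every
  element of \<open>H\<close> to exactly \<open>|Z(G)|\<close> elements of \<open>G\<close>. Counting the pairs of related tuples in two
  ways gives the equality of the probabilities (lemma \<open>biregular_tuple_ratio\<close>).
\<close>

section \<open>Counting tuples along a biregular relation\<close>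

lemma card_related_tuples:
  assumes fin: "finite I" "finite A" "finite B"
    and K: "K \<subseteq> A \<times> B"
    and deg: "\<And>a. a \<in> A \<Longrightarrow> card {b. (a, b) \<in> K} = k"
  shows "card {(g, h). g \<in> I \<rightarrow>\<^sub>E A \<and> h \<in> I \<rightarrow>\<^sub>E B \<and> (\<forall>i\<in>I. (g i, h i) \<in> K) \<and> P g}
    = card {g \<in> I \<rightarrow>\<^sub>E A. P g} * k ^ card I"
proof -
  let ?T = "\<lambda>g. \<Pi>\<^sub>E i\<in>I. {b. (g i, b) \<in> K}"
  have "{(g, h). g \<in> I \<rightarrow>\<^sub>E A \<and> h \<in> I \<rightarrow>\<^sub>E B \<and> (\<forall>i\<in>I. (g i, h i) \<in> K) \<and> P g}
      = Sigma {g \<in> I \<rightarrow>\<^sub>E A. P g} ?T"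
    using K by (auto simp: PiE_iff extensional_def)
  moreover have "finite {b. (a, b) \<in> K}" for a
    by (rule finite_subset[OF _ fin(3)]) (use K in auto)
  then have "\<forall>g\<in>{g \<in> I \<rightarrow>\<^sub>E A. P g}. finite (?T g)"
    by (auto intro!: finite_PiE fin)
  moreover have "card (?T g) = k ^ card I" if "g \<in> {g \<in> I \<rightarrow>\<^sub>E A. P g}" for g
  proof -
    have "card (?T g) = (\<Prod>i\<in>I. card {b. (g i, b) \<in> K})" by (rule card_PiE[OF fin(1)])
    also have "\<dots> = (\<Prod>i\<in>I. k)" using that by (intro prod.cong deg) auto
    finally show ?thesis by simp
  qed
  moreover have "finite {g \<in> I \<rightarrow>\<^sub>E A. P g}" using fin by (simp add: finite_PiE)
  ultimately show ?thesis by (simp add: card_SigmaI)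
qed

text \<open>
  If \<open>K\<close> relates every point of \<open>A\<close> to \<open>k\<close> points of \<open>B\<close> and every point of \<open>B\<close> to \<open>l\<close> points
  of \<open>A\<close>, then a property of tuples that is transported by \<open>K\<close> has the same density in \<open>A\<^sup>I\<close> and
  \<open>B\<^sup>I\<close>: counting related pairs of tuples from either side gives \<open>N\<^sub>A k\<^bsup>|I|\<^esup> = N\<^sub>B l\<^bsup>|I|\<^esup>\<close>.
\<close>
lemma biregular_tuple_ratio:
  assumes fin: "finite I" "finite A" "finite B"
    and K: "K \<subseteq> A \<times> B"
    and degA: "\<And>a. a \<in> A \<Longrightarrow> card {b. (a, b) \<in> K} = k"
    and degB: "\<And>b. b \<in> B \<Longrightarrow> card {a. (a, b) \<in> K} = l"
    and pos: "k > 0" "l > 0"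
    and PQ: "\<And>g h. \<lbrakk>g \<in> I \<rightarrow>\<^sub>E A; h \<in> I \<rightarrow>\<^sub>E B; \<forall>i\<in>I. (g i, h i) \<in> K\<rbrakk> \<Longrightarrow> P g \<longleftrightarrow> Q h"
  shows "real (card {g \<in> I \<rightarrow>\<^sub>E A. P g}) / real (card (I \<rightarrow>\<^sub>E A))
    = real (card {h \<in> I \<rightarrow>\<^sub>E B. Q h}) / real (card (I \<rightarrow>\<^sub>E B))"
proof -
  have count: "card {g \<in> I \<rightarrow>\<^sub>E A. P g} * k ^ card I = card {h \<in> I \<rightarrow>\<^sub>E B. Q h} * l ^ card I"
    if PQ: "\<And>g h. \<lbrakk>g \<in> I \<rightarrow>\<^sub>E A; h \<in> I \<rightarrow>\<^sub>E B; \<forall>i\<in>I. (g i, h i) \<in> K\<rbrakk> \<Longrightarrow> P g \<longleftrightarrow> Q h"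
    for P Q
  proof -
    let ?X = "{(g, h). g \<in> I \<rightarrow>\<^sub>E A \<and> h \<in> I \<rightarrow>\<^sub>E B \<and> (\<forall>i\<in>I. (g i, h i) \<in> K) \<and> P g}"
    let ?Y = "{(h, g). h \<in> I \<rightarrow>\<^sub>E B \<and> g \<in> I \<rightarrow>\<^sub>E A \<and> (\<forall>i\<in>I. (h i, g i) \<in> K\<inverse>) \<and> Q h}"
    have "?Y = ?X\<inverse>" using PQ by auto
    then have "card ?X = card ?Y" by (simp only: card_inverse)
    moreover have "card ?X = card {g \<in> I \<rightarrow>\<^sub>E A. P g} * k ^ card I"
      by (rule card_related_tuples[OF fin K degA])
    moreover have "card ?Y = card {h \<in> I \<rightarrow>\<^sub>E B. Q h} * l ^ card I"
      by (rule card_related_tuples) (use fin K degB in auto)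
    ultimately show ?thesis by simp
  qed
  have "real (card {g \<in> I \<rightarrow>\<^sub>E A. P g}) / real (card (I \<rightarrow>\<^sub>E A))
      = real (card {g \<in> I \<rightarrow>\<^sub>E A. P g} * k ^ card I) / real (card (I \<rightarrow>\<^sub>E A) * k ^ card I)"
    using pos by simp
  also have "card {g \<in> I \<rightarrow>\<^sub>E A. P g} * k ^ card I = card {h \<in> I \<rightarrow>\<^sub>E B. Q h} * l ^ card I"
    by (rule count[OF PQ])
  \<comment> \<open>The same count for the property that always holds compares the denominators.\<close>
  also have "card (I \<rightarrow>\<^sub>E A) * k ^ card I = card (I \<rightarrow>\<^sub>E B) * l ^ card I"
    using count[of "\<lambda>_. True" "\<lambda>_. True"] by simp
  finally show ?thesis using pos by simp
qed

section \<open>Values of admissible words\<close>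

lemma word_eval_simps [simp]:
  "word_eval G g [] = \<one>\<^bsub>G\<^esub>"
  "word_eval G g (a # w) = letter_eval G g a \<otimes>\<^bsub>G\<^esub> word_eval G g w"
  by (simp_all add: word_eval_def)

context group
begin

lemma letter_eval_in_subgroup:
  "subgroup K G \<Longrightarrow> g (fst a) \<in> K \<Longrightarrow> letter_eval G g a \<in> K"
  by (simp add: letter_eval_def subgroup.m_inv_closed)

lemma letter_eval_letter_inv:
  "g (fst a) \<in> carrier G \<Longrightarrow> letter_eval G g (letter_inv a) = inv (letter_eval G g a)"
  by (simp add: letter_eval_def letter_inv_def)

lemma word_eval_in_subgroup:
  "subgroup K G \<Longrightarrow> g ` fst ` set w \<subseteq> K \<Longrightarrow> word_eval G g w \<in> K"
  by (induction w) (auto intro: letter_eval_in_subgroup subgroup.m_closed subgroup.one_closed)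

lemma word_eval_append:
  assumes "g ` fst ` set (u @ v) \<subseteq> carrier G"
  shows "word_eval G g (u @ v) = word_eval G g u \<otimes> word_eval G g v"
  using assms
proof (induction u)
  case Nil
  then show ?case using word_eval_in_subgroup[OF subgroup_self] by simp
next
  case (Cons a u)
  then have "letter_eval G g a \<in> carrier G" "word_eval G g u \<in> carrier G"
      "word_eval G g v \<in> carrier G"
    by (auto intro!: letter_eval_in_subgroup word_eval_in_subgroup subgroup_self)
  then show ?case using Cons by (simp add: m_assoc)
qed

end

text \<open>
  Deleting a generator and its inverse keeps a word admissible. The remaining word need not be
  reduced, which is why the values of admissible words are studied without that hypothesis.
\<close>
lemma admissible_Cons_split:
  assumes "admissible (a # w)"
  obtains u v where "w = u @ letter_inv a # v" and "admissible (u @ v)"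
proof -
  have count: "count_list (a # w) (fst b, s) = 1" if "b \<in> set (a # w)" for b s
  proof -
    have "fst b \<in> fst ` set (a # w)" using that by blast
    then show ?thesis using assms unfolding admissible_def by (cases s) (simp_all only:)
  qed
  have "count_list (a # w) (letter_inv a) = 1"
    using count[of a] by (simp add: letter_inv_def)
  moreover have "letter_inv a \<noteq> a" by (simp add: letter_inv_def prod_eq_iff)
  ultimately have "letter_inv a \<in> set w"
    using count_notin by (cases "letter_inv a \<in> set w") auto
  then obtain u v where w: "w = u @ letter_inv a # v" by (meson split_list)
  have "count_list (u @ v) (fst b, s) = 1" if b: "b \<in> set (u @ v)" for b s
  proof -
    have c1: "count_list (a # w) (fst b, s) = 1" for s using count b w by auto
    have "fst b \<noteq> fst a"
    proof
      assume "fst b = fst a"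
      then have "b = a \<or> b = letter_inv a" by (auto simp: letter_inv_def prod_eq_iff)
      moreover have "count_list (u @ v) b \<noteq> 0" using b by (simp add: count_list_0_iff)
      ultimately have "count_list (a # w) b \<noteq> 1" by (auto simp: w)
      then show False using c1[of "snd b"] by simp
    qed
    then have "(fst b, s) \<noteq> a" "(fst b, s) \<noteq> letter_inv a"
      by (auto simp: letter_inv_def)
    then show ?thesis using c1[of s] by (simp add: w)
  qed
  then have "admissible (u @ v)" unfolding admissible_def by blast
  with w that show thesis by blast
qed

lemma (in group) admissible_word_eval_derived:
  assumes K: "subgroup K G" and "admissible w" and "g ` fst ` set w \<subseteq> K"
  shows "word_eval G g w \<in> derived G K"
  using assms(2,3)
proof (induction "length w" arbitrary: w rule: less_induct)
  case less
  have KG: "K \<subseteq> carrier G" using K by (rule subgroup.subset)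
  have D: "subgroup (derived G K) G" using KG by (rule derived_is_subgroup)
  show ?case
  proof (cases w)
    case Nil
    then show ?thesis using subgroup.one_closed[OF D] by simp
  next
    case (Cons a w')
    then obtain u v where w': "w' = u @ letter_inv a # v" and adm: "admissible (u @ v)"
      using less.prems(1) admissible_Cons_split by blast
    let ?x = "letter_eval G g a" and ?u = "word_eval G g u" and ?v = "word_eval G g v"
    have sub: "g ` fst ` set (u @ v) \<subseteq> K" and a: "g (fst a) \<in> K"
      using less.prems(2) by (auto simp: Cons w')
    have xK: "?x \<in> K" using a by (rule letter_eval_in_subgroup[OF K])
    have uK: "?u \<in> K" and vK: "?v \<in> K"
      using sub by (auto intro!: word_eval_in_subgroup[OF K])
    have cG: "?x \<in> carrier G" "?u \<in> carrier G" "?v \<in> carrier G"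
      using xK uK vK KG by auto
    have w'G: "g ` fst ` set w' \<subseteq> carrier G"
      using less.prems(2) KG by (auto simp: Cons)
    have inv: "letter_eval G g (letter_inv a) = inv ?x"
      using a KG by (intro letter_eval_letter_inv) blast
    have "word_eval G g w = ?x \<otimes> (?u \<otimes> (inv ?x \<otimes> ?v))"
      using w'G by (simp add: Cons w' word_eval_append inv)
    \<comment> \<open>The commutator absorbs the leading letter and its inverse; the rest is a shorter word.\<close>
    also have "\<dots> = (?x \<otimes> ?u \<otimes> inv ?x \<otimes> inv ?u) \<otimes> (?u \<otimes> ?v)"
    proof -
      have "inv ?u \<otimes> (?u \<otimes> ?v) = ?v" using cG by (simp flip: m_assoc)
      then show ?thesis using cG by (simp add: m_assoc)
    qed
    also have "?u \<otimes> ?v = word_eval G g (u @ v)"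
      using sub KG by (simp add: word_eval_append)
    also have "(?x \<otimes> ?u \<otimes> inv ?x \<otimes> inv ?u) \<otimes> word_eval G g (u @ v) \<in> derived G K"
    proof (rule subgroup.m_closed[OF D])
      show "?x \<otimes> ?u \<otimes> inv ?x \<otimes> inv ?u \<in> derived G K"
        unfolding derived_def by (rule generate.incl) (use xK uK in blast)
      show "word_eval G g (u @ v) \<in> derived G K"
        using less.hyps[OF _ adm sub] by (simp add: Cons w')
    qed
    finally show ?thesis .
  qed
qed

lemma word_eval_DirProd:
  assumes "group G" "group H"
    and "\<And>i. i \<in> fst ` set w \<Longrightarrow> g i \<in> carrier G" "\<And>i. i \<in> fst ` set w \<Longrightarrow> h i \<in> carrier H"
  shows "word_eval (G \<times>\<times> H) (\<lambda>i. (g i, h i)) w = (word_eval G g w, word_eval H h w)"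
  using assms(3,4)
  by (induction w) (auto simp: letter_eval_def inv_DirProd[OF assms(1,2)])

section \<open>The fibre product of isoclinic groups\<close>

text \<open>
  The fibre product of \<open>G\<close> and \<open>H\<close> over their central quotients, identified by \<open>\<phi>\<close>, as a subset of
  the carrier of \<open>G \<times>\<times> H\<close>.
\<close>
definition fibre_product ::
  "('a, 'm) monoid_scheme \<Rightarrow> ('b, 'k) monoid_scheme \<Rightarrow> ('a set \<Rightarrow> 'b set) \<Rightarrow> ('a \<times> 'b) set"
where
  "fibre_product G H \<phi> = {(a, b). a \<in> carrier G \<and> b \<in> carrier H \<and>
     \<phi> (center G #>\<^bsub>G\<^esub> a) = center H #>\<^bsub>H\<^esub> b}"

lemma (in group) coset_in_FactGroup: "x \<in> carrier G \<Longrightarrow> N #> x \<in> carrier (G Mod N)"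
  by (auto simp: FactGroup_def RCOSETS_def)

text \<open>
  Over each coset \<open>C\<close> of the center lie exactly \<open>|Z(G)|\<close> elements, so this count gives both degrees
  of the relation \<open>fibre_product\<close>.
\<close>
lemma (in group) card_center_coset:
  assumes C: "C \<in> carrier (G Mod center G)"
  shows "card {x \<in> carrier G. center G #> x = C} = card (center G)"
proof -
  have Z: "subgroup (center G) G" by (rule normal_imp_subgroup[OF center_normal])
  have C': "C \<in> rcosets (center G)" using C by (simp add: FactGroup_def)
  then obtain y where y: "y \<in> carrier G" "C = center G #> y" by (auto simp: RCOSETS_def)
  have "{x \<in> carrier G. center G #> x = C} = C"
  proof (intro equalityI subsetI)
    fix x assume "x \<in> {x \<in> carrier G. center G #> x = C}"
    then show "x \<in> C" using rcos_self[OF _ Z] by blast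
  next
    fix x assume "x \<in> C"
    then show "x \<in> {x \<in> carrier G. center G #> x = C}"
      using repr_independence[OF _ y(1) Z] subgroup.elemrcos_carrier[OF Z is_group y(1)] y(2)
      by blast
  qed
  then show ?thesis using card_rcosets_equal[OF C' subgroup.subset[OF Z]] by simp
qed

lemma (in group) card_center_pos:
  assumes "finite (carrier G)"
  shows "card (center G) > 0"
proof -
  have Z: "subgroup (center G) G" by (rule normal_imp_subgroup[OF center_normal])
  show ?thesis
    using subgroup.one_closed[OF Z] finite_subset[OF subgroup.subset[OF Z] assms]
    by (auto simp: card_gt_0_iff)
qed

text \<open>Two groups with a fixed isoclinism between them; finiteness is needed only for counting.\<close>
locale isoclinic_groups = G: group G + H: group H
  for G :: "('a, 'm) monoid_scheme" and H :: "('b, 'k) monoid_scheme" +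
  fixes \<phi> :: "'a set \<Rightarrow> 'b set" and \<psi> :: "'a \<Rightarrow> 'b"
  assumes isoclinism: "isoclinism G H \<phi> \<psi>"
begin

lemma phi_bij: "bij_betw \<phi> (carrier (G Mod center G)) (carrier (H Mod center H))"
  and phi_hom: "\<phi> \<in> hom (G Mod center G) (H Mod center H)"
  using isoclinism by (auto simp: isoclinism_def iso_def)

lemma psi_bij: "bij_betw \<psi> (derived G (carrier G)) (derived H (carrier H))"
  and psi_hom: "\<psi> \<in> hom (derived_group G) (derived_group H)"
  using isoclinism by (auto simp: isoclinism_def iso_def derived_group_def)

lemma psi_commutator:
  assumes "(a, b) \<in> fibre_product G H \<phi>" and "(c, d) \<in> fibre_product G H \<phi>"
  shows "\<psi> (commutator G a c) = commutator H b d"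
proof -
  have ab: "a \<in> carrier G" "b \<in> carrier H" "\<phi> (center G #>\<^bsub>G\<^esub> a) = center H #>\<^bsub>H\<^esub> b"
    and cd: "c \<in> carrier G" "d \<in> carrier H" "\<phi> (center G #>\<^bsub>G\<^esub> c) = center H #>\<^bsub>H\<^esub> d"
    using assms by (auto simp: fibre_product_def)
  have "commutator_map H (\<phi> (center G #>\<^bsub>G\<^esub> a)) (\<phi> (center G #>\<^bsub>G\<^esub> c))
      = \<psi> (commutator_map G (center G #>\<^bsub>G\<^esub> a) (center G #>\<^bsub>G\<^esub> c))"
    using isoclinism ab(1) cd(1) by (simp add: isoclinism_def G.coset_in_FactGroup)
  then show ?thesis
    using ab cd by (simp add: G.commutator_map_coset H.commutator_map_coset)
qed

lemma subgroup_fibre_product: "subgroup (fibre_product G H \<phi>) (G \<times>\<times> H)"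
proof -
  interpret GH: group "G \<times>\<times> H" by (rule DirProd_group[OF G.is_group H.is_group])
  interpret ZG: normal "center G" G by (rule G.center_normal)
  interpret ZH: normal "center H" H by (rule H.center_normal)
  have "group_hom (G Mod center G) (H Mod center H) \<phi>"
    by (intro group_hom.intro group_hom_axioms.intro ZG.factorgroup_is_group
        ZH.factorgroup_is_group phi_hom)
  then interpret phi: group_hom "G Mod center G" "H Mod center H" \<phi> .
  show ?thesis
  proof (rule GH.subgroupI)
    show "fibre_product G H \<phi> \<subseteq> carrier (G \<times>\<times> H)" by (auto simp: fibre_product_def)
    have "\<phi> (center G) = center H" using phi.hom_one by simp
    then have "(\<one>\<^bsub>G\<^esub>, \<one>\<^bsub>H\<^esub>) \<in> fibre_product G H \<phi>"
      by (simp add: fibre_product_def G.coset_mult_one H.coset_mult_one ZG.subset ZH.subset)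
    then show "fibre_product G H \<phi> \<noteq> {}" by blast
  next
    fix p assume "p \<in> fibre_product G H \<phi>"
    then obtain a b where p: "p = (a, b)" "a \<in> carrier G" "b \<in> carrier H"
        "\<phi> (center G #>\<^bsub>G\<^esub> a) = center H #>\<^bsub>H\<^esub> b"
      by (auto simp: fibre_product_def)
    have "\<phi> (center G #>\<^bsub>G\<^esub> inv\<^bsub>G\<^esub> a) = \<phi> (inv\<^bsub>G Mod center G\<^esub> (center G #>\<^bsub>G\<^esub> a))"
      using p by (simp add: ZG.inv_FactGroup G.coset_in_FactGroup ZG.rcos_inv)
    also have "\<dots> = inv\<^bsub>H Mod center H\<^esub> (center H #>\<^bsub>H\<^esub> b)"
      using p by (simp add: G.coset_in_FactGroup)
    also have "\<dots> = center H #>\<^bsub>H\<^esub> inv\<^bsub>H\<^esub> b"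
      using p by (simp add: ZH.inv_FactGroup H.coset_in_FactGroup ZH.rcos_inv)
    finally show "inv\<^bsub>G \<times>\<times> H\<^esub> p \<in> fibre_product G H \<phi>"
      using p by (simp add: inv_DirProd[OF G.is_group H.is_group] fibre_product_def)
  next
    fix p q assume "p \<in> fibre_product G H \<phi>" "q \<in> fibre_product G H \<phi>"
    then obtain a b c d where
        p: "p = (a, b)" "a \<in> carrier G" "b \<in> carrier H"
          "\<phi> (center G #>\<^bsub>G\<^esub> a) = center H #>\<^bsub>H\<^esub> b"
      and q: "q = (c, d)" "c \<in> carrier G" "d \<in> carrier H"
          "\<phi> (center G #>\<^bsub>G\<^esub> c) = center H #>\<^bsub>H\<^esub> d"
      by (auto simp: fibre_product_def)
    have "\<phi> (center G #>\<^bsub>G\<^esub> (a \<otimes>\<^bsub>G\<^esub> c))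
        = \<phi> ((center G #>\<^bsub>G\<^esub> a) \<otimes>\<^bsub>G Mod center G\<^esub> (center G #>\<^bsub>G\<^esub> c))"
      using p q by (simp add: ZG.rcos_sum)
    also have "\<dots> = (center H #>\<^bsub>H\<^esub> b) \<otimes>\<^bsub>H Mod center H\<^esub> (center H #>\<^bsub>H\<^esub> d)"
      using p q by (simp only: phi.hom_mult G.coset_in_FactGroup)
    also have "\<dots> = center H #>\<^bsub>H\<^esub> (b \<otimes>\<^bsub>H\<^esub> d)"
      using p q by (simp add: ZH.rcos_sum)
    finally show "p \<otimes>\<^bsub>G \<times>\<times> H\<^esub> q \<in> fibre_product G H \<phi>"
      using p q by (simp add: fibre_product_def)
  qed
qed

lemma subgroup_graph: "subgroup ((\<lambda>c. (c, \<psi> c)) ` derived G (carrier G)) (G \<times>\<times> H)"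
proof -
  have D: "subgroup (derived G (carrier G)) G" "subgroup (derived H (carrier H)) H"
    by (simp_all add: G.derived_is_subgroup H.derived_is_subgroup)
  have "(\<lambda>c. (c, \<psi> c)) \<in> hom (derived_group G) (G \<times>\<times> H)"
    using psi_hom subgroup.subset[OF D(1)] subgroup.subset[OF D(2)]
    by (auto simp: hom_def derived_group_def Pi_iff)
  then have "group_hom (derived_group G) (G \<times>\<times> H) (\<lambda>c. (c, \<psi> c))"
    unfolding derived_group_def
    by (intro group_hom.intro group_hom_axioms.intro subgroup.subgroup_is_group[OF D(1)]
        G.is_group DirProd_group H.is_group)
  from group_hom.img_is_subgroup[OF this] show ?thesis by (simp add: derived_group_def)
qed

text \<open>
  On the commutator subgroup of the fibre product, the second component is determined by the
  first through \<open>\<psi>\<close>: this holds for commutators by compatibility, and the graph is a subgroup.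
\<close>
lemma derived_fibre_product:
  "derived (G \<times>\<times> H) (fibre_product G H \<phi>) \<subseteq> (\<lambda>c. (c, \<psi> c)) ` derived G (carrier G)"
  unfolding derived_def[of "G \<times>\<times> H"]
proof (rule group.generate_subgroup_incl[OF DirProd_group[OF G.is_group H.is_group] _ subgroup_graph])
  show "derived_set (G \<times>\<times> H) (fibre_product G H \<phi>) \<subseteq> (\<lambda>c. (c, \<psi> c)) ` derived G (carrier G)"
  proof
    fix x assume "x \<in> derived_set (G \<times>\<times> H) (fibre_product G H \<phi>)"
    then obtain p q where p: "p \<in> fibre_product G H \<phi>" and q: "q \<in> fibre_product G H \<phi>"
        and x: "x = p \<otimes>\<^bsub>G \<times>\<times> H\<^esub> q \<otimes>\<^bsub>G \<times>\<times> H\<^esub> inv\<^bsub>G \<times>\<times> H\<^esub> p \<otimes>\<^bsub>G \<times>\<times> H\<^esub> inv\<^bsub>G \<times>\<times> H\<^esub> q"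
      by blast
    obtain a b c d where pq: "p = (a, b)" "q = (c, d)" by (cases p, cases q)
    then have mem: "a \<in> carrier G" "b \<in> carrier H" "c \<in> carrier G" "d \<in> carrier H"
      using p q by (auto simp: fibre_product_def)
    then have "x = (commutator G a c, commutator H b d)"
      using x pq by (simp add: commutator_def inv_DirProd[OF G.is_group H.is_group])
    also have "commutator H b d = \<psi> (commutator G a c)"
      using psi_commutator p q pq by simp
    finally have "x = (commutator G a c, \<psi> (commutator G a c))" .
    moreover have "commutator G a c \<in> derived G (carrier G)"
      unfolding commutator_def derived_def by (rule generate.incl) (use mem in blast)
    ultimately show "x \<in> (\<lambda>c. (c, \<psi> c)) ` derived G (carrier G)" by blast
  qed
qed

lemma psi_word_eval:
  assumes adm: "admissible w"
    and rel: "\<And>i. i \<in> fst ` set w \<Longrightarrow> (g i, h i) \<in> fibre_product G H \<phi>"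
  shows "word_eval G g w \<in> derived G (carrier G)"
    and "word_eval H h w = \<psi> (word_eval G g w)"
proof -
  have "word_eval (G \<times>\<times> H) (\<lambda>i. (g i, h i)) w \<in> derived (G \<times>\<times> H) (fibre_product G H \<phi>)"
    by (rule group.admissible_word_eval_derived[OF DirProd_group[OF G.is_group H.is_group]
          subgroup_fibre_product adm]) (use rel in auto)
  also have "word_eval (G \<times>\<times> H) (\<lambda>i. (g i, h i)) w = (word_eval G g w, word_eval H h w)"
    by (rule word_eval_DirProd[OF G.is_group H.is_group])
      (use rel in \<open>auto simp: fibre_product_def\<close>)
  finally have "(word_eval G g w, word_eval H h w) \<in> (\<lambda>c. (c, \<psi> c)) ` derived G (carrier G)"
    using derived_fibre_product by blast
  then show "word_eval G g w \<in> derived G (carrier G)"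
    and "word_eval H h w = \<psi> (word_eval G g w)" by auto
qed

lemma card_fibre_left:
  assumes a: "a \<in> carrier G"
  shows "card {b. (a, b) \<in> fibre_product G H \<phi>} = card (center H)"
proof -
  have "\<phi> (center G #>\<^bsub>G\<^esub> a) \<in> carrier (H Mod center H)"
    using phi_bij G.coset_in_FactGroup[OF a] by (rule bij_betw_apply)
  moreover have "{b. (a, b) \<in> fibre_product G H \<phi>}
      = {b \<in> carrier H. center H #>\<^bsub>H\<^esub> b = \<phi> (center G #>\<^bsub>G\<^esub> a)}"
    using a by (auto simp: fibre_product_def)
  ultimately show ?thesis by (simp add: H.card_center_coset)
qed

lemma card_fibre_right:
  assumes b: "b \<in> carrier H"
  shows "card {a. (a, b) \<in> fibre_product G H \<phi>} = card (center G)"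
proof -
  have "center H #>\<^bsub>H\<^esub> b \<in> \<phi> ` carrier (G Mod center G)"
    using H.coset_in_FactGroup[OF b] phi_bij by (simp add: bij_betw_def)
  then obtain C where C: "C \<in> carrier (G Mod center G)" "\<phi> C = center H #>\<^bsub>H\<^esub> b" by auto
  have "\<phi> (center G #>\<^bsub>G\<^esub> a) = \<phi> C \<longleftrightarrow> center G #>\<^bsub>G\<^esub> a = C" if "a \<in> carrier G" for a
    using bij_betw_imp_inj_on[OF phi_bij] G.coset_in_FactGroup[OF that] C(1)
    by (rule inj_on_eq_iff)
  then have "{a. (a, b) \<in> fibre_product G H \<phi>} = {a \<in> carrier G. center G #>\<^bsub>G\<^esub> a = C}"
    using b by (auto simp: fibre_product_def simp flip: C(2))
  then show ?thesis by (simp add: G.card_center_coset[OF C(1)])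
qed

theorem word_prob_eq:
  assumes fin: "finite (carrier G)" "finite (carrier H)"
    and x: "x \<in> derived G (carrier G)"
    and w: "fst ` set w \<subseteq> {1..n}" "admissible w"
  shows "word_prob G n w x = word_prob H n w (\<psi> x)"
  unfolding word_prob_def
proof (rule biregular_tuple_ratio)
  show "fibre_product G H \<phi> \<subseteq> carrier G \<times> carrier H" by (auto simp: fibre_product_def)
  show "card {b. (a, b) \<in> fibre_product G H \<phi>} = card (center H)" if "a \<in> carrier G" for a
    using that by (rule card_fibre_left)
  show "card {a. (a, b) \<in> fibre_product G H \<phi>} = card (center G)" if "b \<in> carrier H" for b
    using that by (rule card_fibre_right)
  show "card (center H) > 0" "card (center G) > 0"
    using fin by (simp_all add: G.card_center_pos H.card_center_pos)
next
  fix g h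
  assume "\<forall>i\<in>{1..n}. (g i, h i) \<in> fibre_product G H \<phi>"
  then have "word_eval G g w \<in> derived G (carrier G)"
    and eq: "word_eval H h w = \<psi> (word_eval G g w)"
    using psi_word_eval[OF w(2)] w(1) by blast+
  then show "word_eval G g w = x \<longleftrightarrow> word_eval H h w = \<psi> x"
    using inj_on_eq_iff[OF bij_betw_imp_inj_on[OF psi_bij] _ x] by simp
qed (use fin in simp_all)

end

theorem proposition4p1p3:
  fixes G :: "('a, 'm) monoid_scheme" and H :: "('b, 'k) monoid_scheme"
    and \<phi> :: "'a set \<Rightarrow> 'b set" and \<psi> :: "'a \<Rightarrow> 'b"
    and g :: 'a and n :: nat and \<omega> :: "letter list"
  assumes "group G" and "finite (carrier G)"
    and "group H" and "finite (carrier H)"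
    and "isoclinism G H \<phi> \<psi>"
    and "g \<in> derived G (carrier G)"
    and "\<omega> \<in> carrier (free_group n)"
    and "\<omega> \<noteq> \<one>\<^bsub>free_group n\<^esub>"
    and "admissible \<omega>"
  shows "word_prob G n \<omega> g = word_prob H n \<omega> (\<psi> g)"
proof -
  interpret isoclinic_groups G H \<phi> \<psi>
    using assms(1,3,5) by (simp add: isoclinic_groups_def isoclinic_groups_axioms_def)
  have "fst ` set \<omega> \<subseteq> {1..n}" using assms(7) by (simp add: free_group_def)
  then show ?thesis using assms(2,4,6,9) by (intro word_prob_eq)
qed

end
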